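(* Let $E,E'$ be real normed vector spaces, $U$ an open subset of $E$, $a\in U$ and $f:U\to E'$ a map. Suppose $f$ is differentiable (in the Fréchet sense) at $a$, with differential $\mathrm{d}f_a$. Then: (i) the centred map $f:(E_a,U)\to(E'_{f(a)},E')$ is $\mathbb R$-contactable, where $E_a$ and $E'_{f(a)}$ carry the standard $\mathbb R$-contracting structures, and its $\mathbb R$-contact is $\mathrm{K}_{\mathbb R}f(x)=f(a)+\mathrm{d}f_a(x-a)$ for $x\in E$; (ii) for every valued monoid $\Sigma$, the centred map $f:(E_a,U)\to(E'_{f(a)},E')$ is $\Sigma$-contactable, where $E_a$ and $E'_{f(a)}$ carry the canonical $\Sigma$-contracting structures, and its $\Sigma$-contact is $\mathrm{K}_\Sigma f=\mathrm{K}_{\mathbb R}f$, i.e. $\mathrm{K}_\Sigma f(x)=f(a)+\mathrm{d}f_a(x-a)$.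
   Context: A valued monoid is a (multiplicatively written) monoid $\Sigma$ with an absorbing element $0$, equipped with a monoid homomorphism $v:\Sigma\to\mathbb R_+=[0,+\infty[$ (multiplicative), called the valuation, such that $v(t)=0\iff t=0$, and there exists $t\in\Sigma$ with $0<v(t)<1$. $\mathbb R$ is a valued monoid under multiplication with valuation the absolute value. A $\Sigma$-contracting space is a metric space $M$ with a central point $\omega\in M$ and an operation $\Sigma\times M\to M$, $(t,x)\mapsto t\star x$, such that $1\star x=x$; $t'\star(t\star x)=(t'\cdot t)\star x$; $0\star\omega=\omega$; $d(t\star x,t\star y)=v(t)d(x,y)$. A map $h$ between $\Sigma$-contracting spaces is $\Sigma$-homogeneous if $h(t\star x)=t\star h(x)$ for all $t,x$. For a real normed vector space $E$ and $a\in E$, $E_a$ denotes $E$ with central point $\omega=a$. Its standard $\mathbb R$-contracting structure is $t\star x=a+t(x-a)$, $t\in\mathbb R$. For any valued monoid $\Sigma$ its canonical $\Sigma$-contracting structure is $t\star x=a+v(t)(x-a)$, $t\in\Sigma$. Let $M,M'$ be $\Sigma$-contracting spaces and $V,V'$ neighborhoods of $\omega$ in $M$, $M'$ respectively. A centred map $f:(M,V)\to(M',V')$ is a map $f:V\to V'$ with $f(\omega)=\omega$. It is $\Sigma$-contactable if there exists a $\Sigma$-homogeneous Lipschitz map $h:M\to M'$ such that $f$ is tangent to $h|_V$ at $\omega$, i.e. $\forall\varepsilon>0\ \exists\eta>0\ \forall x\in V\ (d(x,\omega)\le\eta\Rightarrow d(f(x),h(x))\le\varepsilon\,d(x,\omega))$.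 Such $h$ is unique, is denoted $\mathrm{K}_\Sigma f$ and called the $\Sigma$-contact of $f$. *)

theory Defs
  imports "HOL-Analysis.Analysis"
begin

text \<open>
  The monoid \<open>\<Sigma>\<close> with its absorbing element \<open>0\<close> is a type of sort
  \<open>{monoid_mult, mult_zero}\<close>; no commutativity is assumed. A single type may carry several
  valuations, so the valuation \<open>v\<close> is an explicit argument throughout.
\<close>

locale valued_monoid =
  fixes v :: "'s::{monoid_mult, mult_zero} \<Rightarrow> real"
  assumes val_nonneg: "0 \<le> v t"
    and val_one: "v 1 = 1"
    and val_mult: "v (s * t) = v s * v t"
    and val_eq_0_iff: "v t = 0 \<longleftrightarrow> t = 0"
    and val_nontrivial: "\<exists>t. 0 < v t \<and> v t < 1"

text \<open>
  The underlying metric space is the whole type \<open>'m\<close>; the record holds the additional structure.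
\<close>

record ('s, 'm) pointed_action =
  centre :: 'm
  act :: "'s \<Rightarrow> 'm \<Rightarrow> 'm"

locale contracting_space = valued_monoid v
  for v :: "'s::{monoid_mult, mult_zero} \<Rightarrow> real" +
  fixes M :: "('s, 'm::metric_space) pointed_action"
  assumes act_one: "act M 1 x = x"
    and act_act: "act M t' (act M t x) = act M (t' * t) x"
    and act_zero_centre: "act M 0 (centre M) = centre M"
    and dist_act: "dist (act M t x) (act M t y) = v t * dist x y"

definition homogeneous ::
    "('s, 'm) pointed_action \<Rightarrow> ('s, 'n) pointed_action \<Rightarrow> ('m \<Rightarrow> 'n) \<Rightarrow> bool" where
  "homogeneous M M' h \<longleftrightarrow> (\<forall>t x. h (act M t x) = act M' t (h x))"

text \<open>
  A map defined on \<open>V\<close> is represented by a total function of which only the values on \<open>V\<close>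
  are used.
\<close>

definition centred_map ::
    "('s, 'm::metric_space) pointed_action \<Rightarrow> 'm set \<Rightarrow>
     ('s, 'n::metric_space) pointed_action \<Rightarrow> 'n set \<Rightarrow> ('m \<Rightarrow> 'n) \<Rightarrow> bool" where
  "centred_map M V M' V' f \<longleftrightarrow>
     centre M \<in> interior V \<and> centre M' \<in> interior V' \<and>
     f ` V \<subseteq> V' \<and> f (centre M) = centre M'"

definition tangent_at ::
    "'m::metric_space \<Rightarrow> 'm set \<Rightarrow> ('m \<Rightarrow> 'n::metric_space) \<Rightarrow> ('m \<Rightarrow> 'n) \<Rightarrow> bool" where
  "tangent_at w V f h \<longleftrightarrow>
     (\<forall>\<epsilon>>0. \<exists>\<eta>>0. \<forall>x\<in>V. dist x w \<le> \<eta> \<longrightarrow> dist (f x) (h x) \<le> \<epsilon> * dist x w)"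

definition is_contact ::
    "('s, 'm::metric_space) pointed_action \<Rightarrow> 'm set \<Rightarrow>
     ('s, 'n::metric_space) pointed_action \<Rightarrow> ('m \<Rightarrow> 'n) \<Rightarrow> ('m \<Rightarrow> 'n) \<Rightarrow> bool" where
  "is_contact M V M' f h \<longleftrightarrow>
     homogeneous M M' h \<and> (\<exists>C. C-lipschitz_on UNIV h) \<and> tangent_at (centre M) V f h"

definition contactable ::
    "('s::{monoid_mult, mult_zero} \<Rightarrow> real) \<Rightarrow>
     ('s, 'm::metric_space) pointed_action \<Rightarrow> 'm set \<Rightarrow>
     ('s, 'n::metric_space) pointed_action \<Rightarrow> 'n set \<Rightarrow> ('m \<Rightarrow> 'n) \<Rightarrow> bool" where
  "contactable v M V M' V' f \<longleftrightarrow>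
     contracting_space v M \<and> contracting_space v M' \<and> centred_map M V M' V' f \<and>
     (\<exists>h. is_contact M V M' f h)"

text \<open>
  Meaningful when \<open>f\<close> is contactable: the map \<open>h\<close> is then unique.
\<close>

definition contact ::
    "('s, 'm::metric_space) pointed_action \<Rightarrow> 'm set \<Rightarrow>
     ('s, 'n::metric_space) pointed_action \<Rightarrow> ('m \<Rightarrow> 'n) \<Rightarrow> 'm \<Rightarrow> 'n" where
  "contact M V M' f = (THE h. is_contact M V M' f h)"

text \<open>
  The valuation of \<open>\<real>\<close> as a valued monoid is \<^term>\<open>abs :: real \<Rightarrow> real\<close>. For
  \<open>\<Sigma> = \<real>\<close> the two structures below differ: the standard one scales by \<open>t\<close>, the canonical
  one by \<open>\<bar>t\<bar>\<close>.
\<close>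

definition standard_space :: "'a::real_normed_vector \<Rightarrow> (real, 'a) pointed_action" where
  "standard_space a = \<lparr>centre = a, act = (\<lambda>t x. a + t *\<^sub>R (x - a))\<rparr>"

definition canonical_space ::
    "('s \<Rightarrow> real) \<Rightarrow> 'a::real_normed_vector \<Rightarrow> ('s, 'a) pointed_action" where
  "canonical_space v a = \<lparr>centre = a, act = (\<lambda>t x. a + v t *\<^sub>R (x - a))\<rparr>"

end

theory Submission
  imports Defs
begin

text \<open>
  A contact is unique because some \<open>t\<close> with \<open>0 < v t < 1\<close> exists: moving \<open>x\<close> to
  \<open>t ^ n \<star> x\<close> brings it into the range where two contacts differ by at most
  \<open>\<epsilon> d(x, \<omega>)\<close>, and homogeneity scales both sides of this estimate by the same factor.
  Differentiability says that the affine map \<open>x \<mapsto> f a + df (x - a)\<close> is tangent to \<open>f\<close> at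
  \<open>a\<close>, and linearity of \<open>df\<close> makes it homogeneous for all structures concerned.
\<close>

lemma (in valued_monoid) val_power: "v (t ^ n) = v t ^ n"
  by (induction n) (simp_all add: val_one val_mult)

text \<open>Only the element \<open>0\<close> is assumed to fix the centre. Writing the centre as
  the image of itself under \<open>0\<close> and using \<open>t * 0 = 0\<close> extends this to
  every \<open>t\<close>.\<close>

lemma (in contracting_space) act_centre: "act M t (centre M) = centre M"
  using act_act[of t 0 "centre M"] by (simp add: act_zero_centre)

lemma (in contracting_space) dist_act_centre:
  "dist (act M t x) (centre M) = v t * dist x (centre M)"
  using dist_act[of t x "centre M"] by (simp add: act_centre)

lemma tangent_at_unique:
  assumes M: "contracting_space v M" and M': "contracting_space v M'"
    and V: "centre M \<in> interior V"
    and h: "homogeneous M M' h" "tangent_at (centre M) V f h"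
    and k: "homogeneous M M' k" "tangent_at (centre M) V f k"
  shows "h = k"
proof
  fix x
  interpret M: contracting_space v M by (fact M)
  interpret M': contracting_space v M' by (fact M')
  let ?w = "centre M"
  obtain r where r: "r > 0" "ball ?w r \<subseteq> V"
    using V mem_interior by blast
  obtain t where t: "0 < v t" "v t < 1"
    using M.val_nontrivial by blast
  have lim: "(\<lambda>n. v t ^ n * dist x ?w) \<longlonglongrightarrow> 0"
    using t by (intro tendsto_mult_left_zero LIMSEQ_power_zero) simp
  have "dist (h x) (k x) \<le> 0 + e" if e: "e > 0" for e
  proof -
    \<comment> \<open>The two tangency estimates add up to a factor \<open>2 * \<epsilon>\<close>;
      the summand \<open>1\<close> keeps the denominator positive even when \<open>x\<close> is the
      centre.\<close>
    define \<epsilon> where "\<epsilon> = e / (2 * (dist x ?w + 1))"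
    have \<epsilon>: "\<epsilon> > 0"
      using e by (simp add: \<epsilon>_def add_nonneg_pos)
    obtain p where p: "p > 0"
        "\<And>y. y \<in> V \<Longrightarrow> dist y ?w \<le> p \<Longrightarrow> dist (f y) (h y) \<le> \<epsilon> * dist y ?w"
      using h(2) \<epsilon> unfolding tangent_at_def by metis
    obtain q where q: "q > 0"
        "\<And>y. y \<in> V \<Longrightarrow> dist y ?w \<le> q \<Longrightarrow> dist (f y) (k y) \<le> \<epsilon> * dist y ?w"
      using k(2) \<epsilon> unfolding tangent_at_def by metis
    have "\<forall>\<^sub>F n in sequentially. v t ^ n * dist x ?w < min r (min p q)"
      using order_tendstoD(2)[OF lim, of "min r (min p q)"] r(1) p(1) q(1) by simp
    \<comment> \<open>The bound \<open>r\<close> puts the contracted point into \<open>V\<close>,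
      while \<open>p\<close> and \<open>q\<close> make both tangency estimates apply to it.\<close>
    then obtain n where n: "v t ^ n * dist x ?w < min r (min p q)"
      unfolding eventually_sequentially by blast
    define y where "y = act M (t ^ n) x"
    have y: "dist y ?w = v t ^ n * dist x ?w"
      by (simp add: y_def M.dist_act_centre M.val_power)
    have "y \<in> V"
      using n r y by (auto simp: dist_commute)
    then have "dist (f y) (h y) \<le> \<epsilon> * dist y ?w" "dist (f y) (k y) \<le> \<epsilon> * dist y ?w"
      using n y p(2)[of y] q(2)[of y] by simp_all
    then have "dist (h y) (k y) \<le> 2 * \<epsilon> * dist y ?w"
      using dist_triangle3[of "h y" "k y" "f y"] by linarith
    moreover have "dist (h y) (k y) = v t ^ n * dist (h x) (k x)"
      using h(1) k(1) by (simp add: homogeneous_def y_def M'.dist_act M.val_power)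
    ultimately have "v t ^ n * dist (h x) (k x) \<le> v t ^ n * (2 * \<epsilon> * dist x ?w)"
      by (simp add: y mult_ac)
    then have "dist (h x) (k x) \<le> 2 * \<epsilon> * dist x ?w"
      using t by simp
    also have "\<dots> \<le> 2 * \<epsilon> * (dist x ?w + 1)"
      using \<epsilon> by simp
    also have "\<dots> = e"
      using add_nonneg_pos[OF zero_le_dist[of x ?w] zero_less_one] by (simp add: \<epsilon>_def field_simps)
    finally show ?thesis by simp
  qed
  then have "dist (h x) (k x) \<le> 0"
    by (rule field_le_epsilon)
  then show "h x = k x" by simp
qed

text \<open>By uniqueness, exhibiting one contact determines the definite description.\<close>

lemma contact_eqI:
  assumes "contracting_space v M" and "contracting_space v M'"
    and "centre M \<in> interior V" and "is_contact M V M' f h"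
  shows "contact M V M' f = h"
  unfolding contact_def
  using assms tangent_at_unique[OF assms(1-3)]
  by (intro the_equality) (auto simp: is_contact_def)

lemma valued_monoid_abs: "valued_monoid (abs :: real \<Rightarrow> real)"
proof
  show "\<exists>t::real. 0 < \<bar>t\<bar> \<and> \<bar>t\<bar> < 1"
    by (intro exI[of _ "1/2"]) simp
qed (simp_all add: abs_mult)

lemma contracting_space_standard: "contracting_space abs (standard_space a)"
proof -
  interpret valued_monoid "abs :: real \<Rightarrow> real" by (fact valued_monoid_abs)
  show ?thesis
    by unfold_locales
      (simp_all add: standard_space_def dist_norm flip: scaleR_diff_right)
qed

text \<open>Scaling by \<open>v t\<close> multiplies norms by \<open>\<bar>v t\<bar>\<close>, which
  equals \<open>v t\<close> because valuations are nonnegative; multiplicativity of \<open>v\<close>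
  gives the action law.\<close>

lemma contracting_space_canonical:
  assumes "valued_monoid v"
  shows "contracting_space v (canonical_space v a)"
proof -
  interpret valued_monoid v by (fact assms)
  show ?thesis
    by unfold_locales
      (simp_all add: canonical_space_def dist_norm val_one val_mult val_nonneg
        flip: scaleR_diff_right)
qed

lemma has_derivative_imp_tangent_at:
  assumes "(f has_derivative df) (at a within U)"
  shows "tangent_at a U f (\<lambda>x. f a + df (x - a))"
  unfolding tangent_at_def
proof (intro allI impI)
  fix \<epsilon> :: real
  assume "\<epsilon> > 0"
  then obtain d where d: "d > 0"
      "\<And>y. y \<in> U \<Longrightarrow> norm (y - a) < d \<Longrightarrow>
         norm (f y - f a - df (y - a)) \<le> \<epsilon> * norm (y - a)"
    using assms unfolding has_derivative_within_alt by metis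
  show "\<exists>\<eta>>0. \<forall>x\<in>U. dist x a \<le> \<eta> \<longrightarrow> dist (f x) (f a + df (x - a)) \<le> \<epsilon> * dist x a"
    \<comment> \<open>Halving \<open>d\<close> turns the non-strict bound in
      \<open>tangent_at\<close> into the strict one of the derivative.\<close>
    using d by (intro exI[of _ "d / 2"]) (auto simp: dist_norm diff_diff_eq)
qed

text \<open>Both translations cancel in differences, leaving \<open>g (x - y)\<close>, so a norm
  bound for \<open>g\<close> is a Lipschitz constant.\<close>

lemma bounded_linear_imp_affine_lipschitz:
  assumes "bounded_linear g"
  shows "\<exists>C. C-lipschitz_on UNIV (\<lambda>x. b + g (x - a))"
proof -
  interpret bounded_linear g by (fact assms)
  obtain K where K: "K \<ge> 0" "\<And>x. norm (g x) \<le> norm x * K"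
    using nonneg_bounded by blast
  have "K-lipschitz_on UNIV (\<lambda>x. b + g (x - a))"
  proof (rule lipschitz_onI)
    fix x y
    show "dist (b + g (x - a)) (b + g (y - a)) \<le> K * dist x y"
      using K(2)[of "x - y"] by (simp add: dist_norm mult.commute flip: diff)
  qed (fact K(1))
  then show ?thesis ..
qed

lemma linear_imp_homogeneous_standard:
  assumes "linear g"
  shows "homogeneous (standard_space a) (standard_space b) (\<lambda>x. b + g (x - a))"
  by (simp add: homogeneous_def standard_space_def linear_scale[OF assms])

text \<open>A linear map commutes with all real scalars, in particular with every
  \<open>v t\<close>; hence one affine map serves all valuations.\<close>

lemma linear_imp_homogeneous_canonical:
  assumes "linear g"
  shows "homogeneous (canonical_space v a) (canonical_space v b) (\<lambda>x. b + g (x - a))"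
  by (simp add: homogeneous_def canonical_space_def linear_scale[OF assms])

theorem proposition2p2p17:
  fixes f :: "'a::real_normed_vector \<Rightarrow> 'b::real_normed_vector"
    and df :: "'a \<Rightarrow> 'b" and U :: "'a set" and a :: 'a
  assumes "open U" and "a \<in> U"
    and "(f has_derivative df) (at a within U)"
  shows "(contactable abs (standard_space a) U (standard_space (f a)) UNIV f \<and>
          contact (standard_space a) U (standard_space (f a)) f = (\<lambda>x. f a + df (x - a))) \<and>
         (\<forall>v :: 's::{monoid_mult, mult_zero} \<Rightarrow> real. valued_monoid v \<longrightarrow>
            contactable v (canonical_space v a) U (canonical_space v (f a)) UNIV f \<and>
            contact (canonical_space v a) U (canonical_space v (f a)) f =
              contact (standard_space a) U (standard_space (f a)) f \<and>
            contact (canonical_space v a) U (canonical_space v (f a)) f =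
              (\<lambda>x. f a + df (x - a)))"
proof -
  let ?h = "\<lambda>x. f a + df (x - a)"
  have df: "bounded_linear df" "linear df"
    using assms(3) has_derivative_bounded_linear has_derivative_linear by blast+
  have a: "a \<in> interior U"
    using assms(1,2) by (simp add: interior_open)
  note affine = bounded_linear_imp_affine_lipschitz[OF df(1)]
    has_derivative_imp_tangent_at[OF assms(3)]
  have std: "is_contact (standard_space a) U (standard_space (f a)) f ?h"
    using affine linear_imp_homogeneous_standard[OF df(2)]
    by (simp add: is_contact_def standard_space_def)
  \<comment> \<open>The Lipschitz bound and tangency do not involve the action, so
    \<open>affine\<close> serves again and only homogeneity changes.\<close>
  have can: "is_contact (canonical_space v a) U (canonical_space v (f a)) f ?h"
    for v :: "'s \<Rightarrow> real"
    using affine linear_imp_homogeneous_canonical[OF df(2)]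
    by (simp add: is_contact_def canonical_space_def)
  have cstd: "contact (standard_space a) U (standard_space (f a)) f = ?h"
    using a std
    \<comment> \<open>The valuation does not occur in \<open>contact\<close>, so unification cannot
      find it and it is given explicitly.\<close>
    by (intro contact_eqI[where v = abs] contracting_space_standard)
      (simp_all add: standard_space_def)
  have ccan: "contact (canonical_space v a) U (canonical_space v (f a)) f = ?h"
    if "valued_monoid v" for v :: "'s \<Rightarrow> real"
    using a can[of v] that
    by (intro contact_eqI[where v = v] contracting_space_canonical)
      (simp_all add: canonical_space_def)
  have "contactable abs (standard_space a) U (standard_space (f a)) UNIV f"
    using std a contracting_space_standard[of a] contracting_space_standard[of "f a"]
    by (auto simp: contactable_def centred_map_def standard_space_def)
  moreover have "contactable v (canonical_space v a) U (canonical_space v (f a)) UNIV f"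
    if "valued_monoid v" for v :: "'s \<Rightarrow> real"
    using can[of v] a contracting_space_canonical[OF that, of a]
      contracting_space_canonical[OF that, of "f a"]
    by (auto simp: contactable_def centred_map_def canonical_space_def)
  ultimately show ?thesis
    using cstd ccan by simp
qed

end
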